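(* Let the poset ideal (down-set) $\mathcal I\subseteq\mathrm{Hom}([n],[e]_0)$ correspond to the poset ideal $I\subseteq F_e(n+2e)$ by the isomorphism $\Psi$ (where $\mathrm{Hom}([n],[e]_0)$ is identified with $\mathrm{Hom}([e],[n]_0)$ by passing to dual partitions). Then the Stanley-Reisner ideal of the squeezed ball $B(I)$ is the ideal $L^\alpha(\mathcal I;[n],[e]_0)$.
   Context: Here $n,e\ge 1$ are integers and $k$ is a field. $[n]$ is the chain $\{1<2<\dots<n\}$ and $[e]_0$ is the chain $\{0<1<\dots<e\}$. For posets $P,Q$, $\mathrm{Hom}(P,Q)$ is the set of order-preserving maps $P\to Q$, partially ordered by $\phi\preceq\psi$ iff $\phi(p)\le\psi(p)$ for every $p\in P$. Squeezed balls: $F_e$ is the set of sequences of natural numbers $\mathbf i: 1\le i_1<i_2<\dots<i_e$ such that each difference $i_p-i_{p-1}\ge 2$, partially ordered by $\mathbf i\le\mathbf j$ iff each $i_p\le j_p$. $F_e(m)$ is the subset of such sequences with $i_e<m$. For $\mathbf i\in F_e$ let $\hat{\mathbf i}=\{i_1,i_1+1,i_2,i_2+1,\dots,i_e,i_e+1\}$. For a finite down-set $I$ in $F_e$, the squeezed ball $B(I)$ is the simplicial complex with facets $\hat{\mathbf i}$ for $\mathbf i\in I$. For $I\subseteq F_e(n+2e)$ it is regarded as a simplicial complex on $[n+2e]$, and its Stanley-Reisner ideal in $k[x_1,\dots,x_{n+2e}]$ is generated by the monomials $\prod_{s\in R}x_s$ with $R\subseteq[n+2e]$ not a face. The correspondence: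 $\mathrm{Hom}([n],[e]_0)$ and $\mathrm{Hom}([e],[n]_0)$ are identified by mapping a partition to its dual partition: a map $\phi:[n]\to[e]_0$ is characterized by a sequence $0=a_0\le a_1\le\dots\le a_e\le a_{e+1}=n$ such that $\phi$ has value $p$ on the interval $[a_p+1,a_{p+1}]$, and the dual map $\phi':[e]\to[n]_0$ is $\phi'(p)=a_p$. The map $\Psi$ sends $\phi'\in\mathrm{Hom}([e],[n]_0)$ to the map $[e]\to[n+2e-1]$, $p\mapsto \phi'(p)+2p-1$, whose image is the sequence $\mathbf i$ with $i_p=a_p+2p-1$; this gives an isomorphism of posets between $\mathrm{Hom}([e],[n]_0)$ and $F_e(n+2e)$. Letterplace ideals: for a down-set $\mathcal I\subseteq\mathrm{Hom}([n],[e]_0)$, the co-letterplace ideal $L([n],[e]_0;\mathcal I)$ is the ideal in the polynomial ring $k[x_{i,j}: i\in[n],\,j\in[e]_0]$ generated by the monomials $\prod_{i=1}^n x_{i,\phi(i)}$ for $\phi\in\mathcal I$. The letterplace ideal $L(\mathcal I;[n],[e]_0)$ is its Alexander dual, i.e. the ideal generated by all monomials which have a non-trivial common divisor with every monomial in $L([n],[e]_0;\mathcal I)$. The map $\alpha:[n]\times[e]_0\to[n+2e]$, $(i,j)\mapsto i+2j$, induces the map of polynomial rings $\tilde\alpha: k[x_{i,j}]\to k[x_1,\dots,x_{n+2e}]$, $x_{i,j}\mapsto x_{i+2j}$, and $L^\alpha(\mathcal I;[n],[e]_0)\subseteq k[x_1,\dots,x_{n+2e}]$ is the image ideal of $L(\mathcal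 I;[n],[e]_0)$ by $\tilde\alpha$. *)

theory Defs
  imports "HOL-Library.Poly_Mapping" "HOL-Library.FuncSet" "HOL-Algebra.RingHom"
begin

subsection \<open>Order-preserving maps between chains\<close>

text \<open>The chains \<open>[n]\<close> and \<open>[e]\<^sub>0\<close> are \<open>{1..n}\<close> and \<open>{0..e}\<close>. Maps are
  extensional, so that equality of functions is equality of maps.\<close>

definition Hom :: "nat set \<Rightarrow> nat set \<Rightarrow> (nat \<Rightarrow> nat) set" where
  "Hom P Q = {\<phi> \<in> P \<rightarrow>\<^sub>E Q. mono_on P \<phi>}"

definition ple :: "nat set \<Rightarrow> (nat \<Rightarrow> nat) \<Rightarrow> (nat \<Rightarrow> nat) \<Rightarrow> bool" where
  "ple P \<phi> \<psi> \<longleftrightarrow> (\<forall>p\<in>P. \<phi> p \<le> \<psi> p)"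

definition poset_ideal :: "'a set \<Rightarrow> ('a \<Rightarrow> 'a \<Rightarrow> bool) \<Rightarrow> 'a set \<Rightarrow> bool" where
  "poset_ideal S r D \<longleftrightarrow> D \<subseteq> S \<and> (\<forall>x\<in>D. \<forall>y\<in>S. r y x \<longrightarrow> y \<in> D)"


subsection \<open>Squeezed balls\<close>

definition F :: "nat \<Rightarrow> (nat \<Rightarrow> nat) set" where
  "F e = {i \<in> {1..e} \<rightarrow>\<^sub>E {1..}. strict_mono_on {1..e} i \<and> (\<forall>p\<in>{2..e}. i p - i (p - 1) \<ge> 2)}"

definition F_below :: "nat \<Rightarrow> nat \<Rightarrow> (nat \<Rightarrow> nat) set" where
  "F_below e m = {i \<in> F e. i e < m}"

definition hat :: "nat \<Rightarrow> (nat \<Rightarrow> nat) \<Rightarrow> nat set" where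
  "hat e i = (\<Union>p\<in>{1..e}. {i p, i p + 1})"

text \<open>The simplicial complex with facets \<open>hat e i\<close> for \<open>i \<in> I\<close>, as its set of faces.
  For empty \<open>I\<close> it is the void complex, in which not even the empty set is a face.\<close>

definition squeezed_ball :: "nat \<Rightarrow> (nat \<Rightarrow> nat) set \<Rightarrow> nat set set" where
  "squeezed_ball e I = {A. \<exists>i\<in>I. A \<subseteq> hat e i}"


subsection \<open>The correspondence\<close>

definition break_sequence :: "nat \<Rightarrow> nat \<Rightarrow> (nat \<Rightarrow> nat) \<Rightarrow> (nat \<Rightarrow> nat) \<Rightarrow> bool" where
  "break_sequence n e \<phi> a \<longleftrightarrow>
     a 0 = 0 \<and> a (e + 1) = n \<and> mono_on {0..e+1} a \<and>
     (\<forall>p\<in>{0..e}. \<forall>i\<in>{a p + 1..a (p + 1)}. \<phi> i = p)"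

definition dual_partition :: "nat \<Rightarrow> nat \<Rightarrow> (nat \<Rightarrow> nat) \<Rightarrow> (nat \<Rightarrow> nat)" where
  "dual_partition n e \<phi> =
     (THE \<phi>'. \<exists>a. break_sequence n e \<phi> a \<and> \<phi>' = restrict a {1..e})"

definition Psi :: "nat \<Rightarrow> (nat \<Rightarrow> nat) \<Rightarrow> (nat \<Rightarrow> nat)" where
  "Psi e \<phi>' = (\<lambda>p\<in>{1..e}. \<phi>' p + 2 * p - 1)"

lemma break_sequence_eq:
  assumes phi: "\<phi> \<in> Hom {1..n} {0..e}" and a: "break_sequence n e \<phi> a" and p: "p \<le> e + 1"
  shows "a p = card {i\<in>{1..n}. \<phi> i < p}"
proof -
  have mono: "a q \<le> a r" if "q \<le> r" "r \<le> e + 1" for q r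
    using a that by (auto simp: break_sequence_def mono_on_def)
  have val: "\<exists>q\<le>e. a q + 1 \<le> i \<and> i \<le> a (q + 1)" if "i \<in> {1..n}" for i
  proof -
    have ex: "\<exists>q. i \<le> a q \<and> q \<le> e + 1" 
      using a that by (intro exI[of _ "e + 1"]) (auto simp: break_sequence_def)
    define q where "q = (LEAST q. i \<le> a q \<and> q \<le> e + 1)"
    have q: "i \<le> a q \<and> q \<le> e + 1" unfolding q_def using ex by (rule LeastI_ex)
    have "q \<noteq> 0" using q that a by (auto simp: break_sequence_def intro: ccontr)
    then obtain r where r: "q = Suc r" by (cases q) auto
    have "\<not> (i \<le> a r \<and> r \<le> e + 1)"
      using not_less_Least[of r "\<lambda>q. i \<le> a q \<and> q \<le> e + 1"] r q_def by auto
    then show ?thesis using r q by (intro exI[of _ r]) auto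
  qed
  have ap: "a p \<le> n" using mono[OF p] a by (auto simp: break_sequence_def)
  have "{i\<in>{1..n}. \<phi> i < p} = {1..a p}"
  proof (intro Set.set_eqI iffI)
    fix i assume i: "i \<in> {i\<in>{1..n}. \<phi> i < p}"
    then obtain q where q: "q \<le> e" "a q + 1 \<le> i" "i \<le> a (q + 1)" using val by auto
    then have "\<phi> i = q" using a by (auto simp: break_sequence_def)
    then have "a (q + 1) \<le> a p" using i p by (intro mono) auto
    then show "i \<in> {1..a p}" using q i by auto
  next
    fix i assume i: "i \<in> {1..a p}"
    then have i': "i \<in> {1..n}" using ap by auto
    then obtain q where q: "q \<le> e" "a q + 1 \<le> i" "i \<le> a (q + 1)" using val by blast
    then have "\<phi> i = q" using a by (auto simp: break_sequence_def)
    moreover have "q < p" using mono[of p q] q i by (cases "p \<le> q") auto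
    ultimately show "i \<in> {i\<in>{1..n}. \<phi> i < p}" using i' by auto
  qed
  then show ?thesis by simp
qed

lemma break_sequence_exists:
  assumes phi: "\<phi> \<in> Hom {1..n} {0..e}"
  shows "break_sequence n e \<phi> (\<lambda>p. card {i\<in>{1..n}. \<phi> i < p})"
proof -
  let ?S = "\<lambda>p. {i\<in>{1..n}. \<phi> i < p}"
  have monop: "\<phi> i \<le> \<phi> j" if "i \<le> j" "i \<in> {1..n}" "j \<in> {1..n}" for i j
    using phi that by (auto simp: Hom_def mono_on_def)
  have ini: "?S p = {1..card (?S p)}" for p
  proof (cases "?S p = {}")
    case False
    define m where "m = Max (?S p)"
    have m: "m \<in> ?S p" unfolding m_def using False by (intro Max_in) auto
    have "?S p = {1..m}"
    proof (intro Set.set_eqI iffI)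
      fix i assume "i \<in> ?S p" then show "i \<in> {1..m}" unfolding m_def by auto
    next
      fix i assume i: "i \<in> {1..m}"
      then show "i \<in> ?S p" using m monop[of i m] by auto
    qed
    then show ?thesis by simp
  qed simp
  have all: "?S (e + 1) = {1..n}" using phi by (fastforce simp: Hom_def PiE_def Pi_def)
  have mem: "i \<in> ?S p \<longleftrightarrow> 1 \<le> i \<and> i \<le> card (?S p)" for i p
    by (subst ini) simp
  have step: "\<phi> i = p" if "i \<in> {card (?S p) + 1..card (?S (p + 1))}" for i p
  proof -
    have "i \<in> ?S (p + 1)" "i \<notin> ?S p" using that by (subst mem, simp)+
    then show ?thesis by auto
  qed
  have "mono_on {0..e+1} (\<lambda>p. card (?S p))"
    by (intro mono_onI card_mono) auto
  moreover have "card (?S 0) = 0" and "card (?S (e + 1)) = n" by (simp, simp only: all, simp)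
  ultimately show ?thesis unfolding break_sequence_def by (intro conjI ballI step)
qed

lemma dual_partition_eq:
  assumes phi: "\<phi> \<in> Hom {1..n} {0..e}"
  shows "dual_partition n e \<phi> = (\<lambda>p\<in>{1..e}. card {i\<in>{1..n}. \<phi> i < p})"
  unfolding dual_partition_def
proof (rule the_equality)
  show "\<exists>a. break_sequence n e \<phi> a \<and>
      (\<lambda>p\<in>{1..e}. card {i\<in>{1..n}. \<phi> i < p}) = restrict a {1..e}"
    using break_sequence_exists[OF phi] by blast
next
  fix \<phi>' assume "\<exists>a. break_sequence n e \<phi> a \<and> \<phi>' = restrict a {1..e}"
  then show "\<phi>' = (\<lambda>p\<in>{1..e}. card {i\<in>{1..n}. \<phi> i < p})"
    using break_sequence_eq[OF phi] by (auto simp: restrict_def fun_eq_iff)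
qed

text \<open>Passing to the dual partition reverses the pointwise order. Hence a down-set of
  \<open>Hom {1..n} {0..e}\<close> corresponds to an up-set of \<open>F_below e (n + 2 * e)\<close> and conversely, and
  a statement about corresponding poset ideals has to say on which side the ideal is taken.\<close>

lemma dual_partition_antimono:
  assumes "\<phi> \<in> Hom {1..n} {0..e}" "\<psi> \<in> Hom {1..n} {0..e}" "ple {1..n} \<phi> \<psi>"
  shows "ple {1..e} (dual_partition n e \<psi>) (dual_partition n e \<phi>)"
proof -
  have "card {i\<in>{1..n}. \<psi> i < p} \<le> card {i\<in>{1..n}. \<phi> i < p}" for p
    using assms(3) by (intro card_mono) (auto simp: ple_def intro: le_less_trans)
  then show ?thesis using assms(1,2) by (simp add: dual_partition_eq ple_def)
qed


subsection \<open>Polynomial rings\<close>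

type_synonym ('v, 'k) mpoly = "('v \<Rightarrow>\<^sub>0 nat) \<Rightarrow>\<^sub>0 'k"

text \<open>The polynomial ring over the field \<open>'k\<close> in the variables \<open>V\<close>, inside the ring of
  polynomials in all variables of type \<open>'v\<close>.\<close>

definition mpoly_ring :: "'v set \<Rightarrow> ('v, 'k::field) mpoly ring" where
  "mpoly_ring V = \<lparr>carrier = {p. \<forall>m \<in> Poly_Mapping.keys p. Poly_Mapping.keys m \<subseteq> V},
     monoid.mult = (*), one = 1, zero = 0, add = (+)\<rparr>"

definition monomial :: "('v \<Rightarrow>\<^sub>0 nat) \<Rightarrow> ('v, 'k::field) mpoly" where
  "monomial m = Poly_Mapping.single m 1"

definition X :: "'v \<Rightarrow> ('v, 'k::field) mpoly" where
  "X v = monomial (Poly_Mapping.single v 1)"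

text \<open>The substitution homomorphism sending the variable \<open>x\<^sub>v\<close> to \<open>x\<^bsub>f v\<^esub>\<close>.\<close>

definition rename :: "('v \<Rightarrow> 'w) \<Rightarrow> ('v, 'k::field) mpoly \<Rightarrow> ('w, 'k) mpoly" where
  "rename f p = (\<Sum>m\<in>Poly_Mapping.keys p. Poly_Mapping.single 0 (Poly_Mapping.lookup p m) *
     (\<Prod>v\<in>Poly_Mapping.keys m. X (f v) ^ Poly_Mapping.lookup m v))"

definition alexander_dual :: "'v set \<Rightarrow> ('v, 'k::field) mpoly set \<Rightarrow> ('v, 'k) mpoly set" where
  "alexander_dual V L = Idl\<^bsub>mpoly_ring V\<^esub>
     {monomial u | u. Poly_Mapping.keys u \<subseteq> V \<and>
        (\<forall>w. (monomial w :: ('v, 'k) mpoly) \<in> L \<longrightarrow>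
           (\<exists>d. d \<noteq> 0 \<and> (monomial d :: ('v, 'k) mpoly) dvd monomial u \<and>
              (monomial d :: ('v, 'k) mpoly) dvd monomial w))}"

definition stanley_reisner_ideal :: "'v set \<Rightarrow> 'v set set \<Rightarrow> ('v, 'k::field) mpoly set" where
  "stanley_reisner_ideal V \<Delta> = Idl\<^bsub>mpoly_ring V\<^esub> {\<Prod>s\<in>R. X s | R. R \<subseteq> V \<and> R \<notin> \<Delta>}"

lemma cring_mpoly_ring: "cring (mpoly_ring V)"
proof -
  have 1: "p + q \<in> carrier (mpoly_ring V)"
    if "p \<in> carrier (mpoly_ring V)" "q \<in> carrier (mpoly_ring V)" for p q :: "('a, 'b) mpoly"
    using that Poly_Mapping.keys_add[of p q] by (auto simp: mpoly_ring_def)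
  have 2: "p * q \<in> carrier (mpoly_ring V)"
    if p: "p \<in> carrier (mpoly_ring V)" and q: "q \<in> carrier (mpoly_ring V)" for p q :: "('a, 'b) mpoly"
  proof -
    have "Poly_Mapping.keys m \<subseteq> V" if m: "m \<in> Poly_Mapping.keys (p * q)" for m
    proof -
      obtain a b where ab: "m = a + b" "a \<in> Poly_Mapping.keys p" "b \<in> Poly_Mapping.keys q"
        using subsetD[OF Poly_Mapping.keys_mult[of p q] m] by blast
      then show ?thesis
        using p q Poly_Mapping.keys_add[of a b] unfolding mpoly_ring_def partial_object.simps mem_Collect_eq by blast
    qed
    then show ?thesis by (auto simp: mpoly_ring_def)
  qed
  have 3: "- p \<in> carrier (mpoly_ring V)" if "p \<in> carrier (mpoly_ring V)" for p :: "('a, 'b) mpoly"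
    using that by (auto simp: mpoly_ring_def in_keys_iff)
  let ?R = "mpoly_ring V :: ('a, 'b) mpoly ring"
  have ops: "x \<oplus>\<^bsub>?R\<^esub> y = x + y" "x \<otimes>\<^bsub>?R\<^esub> y = x * y" for x y
    by (simp_all add: mpoly_ring_def)
  have units: "\<zero>\<^bsub>?R\<^esub> = 0" "\<one>\<^bsub>?R\<^esub> = 1" "0 \<in> carrier ?R" "1 \<in> carrier ?R"
    by (simp_all add: mpoly_ring_def)
  have "abelian_group ?R"
  proof (rule abelian_groupI)
    fix p assume "p \<in> carrier ?R"
    then show "\<exists>q\<in>carrier ?R. q \<oplus>\<^bsub>?R\<^esub> p = \<zero>\<^bsub>?R\<^esub>"
      using 3[of p] by (intro bexI[of _ "- p"]) (simp_all add: ops units)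
    show "x \<oplus>\<^bsub>?R\<^esub> y = y \<oplus>\<^bsub>?R\<^esub> x" for x y by (simp only: ops add.commute)
  qed (simp_all only: ops units 1 add.assoc add_0)
  moreover have "comm_monoid ?R"
  proof (rule comm_monoidI)
    show "x \<otimes>\<^bsub>?R\<^esub> y = y \<otimes>\<^bsub>?R\<^esub> x" for x y by (simp only: ops mult.commute)
  qed (simp_all only: ops units 2 mult.assoc mult_1)
  ultimately show ?thesis
    by (rule cringI) (simp only: ops distrib_right)
qed


subsection \<open>Letterplace ideals\<close>

abbreviation grid :: "nat \<Rightarrow> nat \<Rightarrow> (nat \<times> nat) set" where
  "grid n e \<equiv> {1..n} \<times> {0..e}"

definition co_letterplace :: "nat \<Rightarrow> nat \<Rightarrow> (nat \<Rightarrow> nat) set \<Rightarrow> (nat \<times> nat, 'k::field) mpoly set" where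
  "co_letterplace n e J = Idl\<^bsub>mpoly_ring (grid n e)\<^esub> {\<Prod>i\<in>{1..n}. X (i, \<phi> i) | \<phi>. \<phi> \<in> J}"

definition letterplace :: "nat \<Rightarrow> nat \<Rightarrow> (nat \<Rightarrow> nat) set \<Rightarrow> (nat \<times> nat, 'k::field) mpoly set" where
  "letterplace n e J = alexander_dual (grid n e) (co_letterplace n e J)"

definition alpha :: "nat \<times> nat \<Rightarrow> nat" where
  "alpha = (\<lambda>(i, j). i + 2 * j)"

text \<open>For \<open>n = 1\<close> the map \<open>rename alpha\<close> is not onto the polynomial ring in \<open>{1..n + 2 * e}\<close>,
  so the image ideal is the ideal generated by the image.\<close>

definition letterplace_alpha :: "nat \<Rightarrow> nat \<Rightarrow> (nat \<Rightarrow> nat) set \<Rightarrow> (nat, 'k::field) mpoly set" where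
  "letterplace_alpha n e J = Idl\<^bsub>mpoly_ring {1..n + 2 * e}\<^esub> (rename alpha ` letterplace n e J)"

end

theory Submission
  imports Defs
begin

text \<open>Placing squares on the values of \<open>i \<mapsto> i + 2 * \<phi> i\<close> and dominoes on the pairs
  \<open>{i p, i p + 1}\<close> tiles \<open>{1..n + 2 * e}\<close>; so a set is a face of the squeezed ball iff it avoids
  the squares of some \<open>\<phi> \<in> J\<close>. A monomial of the letterplace ideal is one whose support meets the
  graph of every \<open>\<phi> \<in> J\<close>, and its image under \<open>alpha\<close> is clearly a multiple of a non-face monomial.
  Conversely, a non-face \<open>R\<close> has to be lifted injectively to such a support. For a down-set \<open>J\<close> let
  \<open>g i\<close> be the least \<open>j \<ge> g (i - 1)\<close> with \<open>i + 2 * j \<notin> R\<close>, and lift \<open>R\<close> to the points \<open>(i, j)\<close>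
  with \<open>g (i - 1) \<le> j < g i\<close>. A \<open>\<phi> \<in> J\<close> that misses all these points lies above \<open>g\<close>; then
  \<open>g \<in> J\<close>, although \<open>g\<close> avoids \<open>R\<close>. Up-sets reduce to down-sets by reversing both chains.\<close>

subsection \<open>Lifting non-faces to the grid\<close>

text \<open>The value at 0 only starts the recursion, since the chain begins at 1. No cap at
  \<open>e\<close> is imposed; that bound is later inherited from an order-preserving map lying
  above.\<close>

fun greedy :: "nat set \<Rightarrow> nat \<Rightarrow> nat" where
  "greedy R 0 = 0"
| "greedy R (Suc i) = (LEAST j. greedy R i \<le> j \<and> Suc i + 2 * j \<notin> R)"

lemma greedy_Suc:
  assumes "finite R"
  shows "greedy R i \<le> greedy R (Suc i)" and "Suc i + 2 * greedy R (Suc i) \<notin> R"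
proof -
  obtain b where b: "\<forall>r\<in>R. r < b"
    using assms finite_nat_set_iff_bounded by blast
  \<comment> \<open>With this \<open>j\<close> the number \<open>Suc i + 2 * j\<close> exceeds
    \<open>b\<close> and so lies beyond all of \<open>R\<close>. Hence the \<open>LEAST\<close>
    ranges over a nonempty set and is attained.\<close>
  then have "greedy R i \<le> b + greedy R i \<and> Suc i + 2 * (b + greedy R i) \<notin> R"
    by auto
  then have "greedy R i \<le> greedy R (Suc i) \<and> Suc i + 2 * greedy R (Suc i) \<notin> R"
    unfolding greedy.simps by (rule LeastI)
  then show "greedy R i \<le> greedy R (Suc i)" and "Suc i + 2 * greedy R (Suc i) \<notin> R"
    by auto
qed

lemma greedy_mono: "finite R \<Longrightarrow> i \<le> k \<Longrightarrow> greedy R i \<le> greedy R k"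
  using lift_Suc_mono_le[of "greedy R", OF greedy_Suc(1)] by blast

text \<open>By minimality, a candidate that the \<open>LEAST\<close> skips can only have failed by
  hitting \<open>R\<close>.\<close>

lemma less_greedy_Suc:
  assumes "greedy R i \<le> j" "j < greedy R (Suc i)"
  shows "Suc i + 2 * j \<in> R"
  using assms not_less_Least[of j "\<lambda>j. greedy R i \<le> j \<and> Suc i + 2 * j \<notin> R"] by auto

declare greedy.simps(2) [simp del]

lemma Hom_le: "\<phi> \<in> Hom {1..n} {0..e} \<Longrightarrow> i \<in> {1..n} \<Longrightarrow> \<phi> i \<le> e"
  by (auto simp: Hom_def)

lemma down_set_lift:
  assumes J: "poset_ideal (Hom {1..n} {0..e}) (ple {1..n}) J"
    and R: "finite R" and hit: "\<And>\<phi>. \<phi> \<in> J \<Longrightarrow> \<exists>i\<in>{1..n}. alpha (i, \<phi> i) \<in> R"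
  shows "\<exists>A \<subseteq> grid n e. inj_on alpha A \<and> alpha ` A \<subseteq> R \<and> (\<forall>\<phi>\<in>J. \<exists>i\<in>{1..n}. (i, \<phi> i) \<in> A)"
proof -
  define A where "A = {(i, j) \<in> grid n e. greedy R (i - 1) \<le> j \<and> j < greedy R i}"
  \<comment> \<open>A later column of \<open>A\<close> starts at height at least
    \<open>greedy R i\<close>, above every point of column \<open>i\<close>. So \<open>alpha\<close>
    can only identify points of one column, where it is clearly injective.\<close>
  have lt: "alpha (i, j) < alpha (i', j')" if "(i, j) \<in> A" "(i', j') \<in> A" "i < i'" for i j i' j'
  proof -
    have "greedy R i \<le> greedy R (i' - 1)" using that(3) by (intro greedy_mono[OF R]) simp
    then show ?thesis using that by (auto simp: A_def alpha_def)
  qed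
  have "inj_on alpha A"
  proof (rule inj_onI, clarify)
    fix i j i' j' assume *: "(i, j) \<in> A" "(i', j') \<in> A" "alpha (i, j) = alpha (i', j')"
    then have "i = i'" using lt[of i j i' j'] lt[of i' j' i j] by (cases i i' rule: linorder_cases) auto
    then show "i = i' \<and> j = j'" using * by (auto simp: alpha_def)
  qed
  moreover have "alpha ` A \<subseteq> R"
  proof clarify
    fix i j assume "(i, j) \<in> A"
    then show "alpha (i, j) \<in> R"
      using less_greedy_Suc[of R "i - 1" j] by (auto simp: A_def alpha_def)
  qed
  moreover have "\<exists>i\<in>{1..n}. (i, \<phi> i) \<in> A" if phi: "\<phi> \<in> J" for \<phi>
  proof (rule ccontr)
    assume miss: "\<not> ?thesis"
    have Hom: "\<phi> \<in> Hom {1..n} {0..e}" using J phi by (auto simp: poset_ideal_def)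
    \<comment> \<open>Monotonicity gives \<open>greedy R i \<le> \<phi> (Suc i)\<close>. If
      \<open>\<phi> (Suc i)\<close> were still below \<open>greedy R (Suc i)\<close>, its graph
      point would lie in \<open>A\<close>. The case \<open>i = 0\<close> is separate because nothing
      is known about \<open>\<phi> 0\<close>.\<close>
    have le: "greedy R i \<le> \<phi> i" if "i \<in> {1..n}" for i
      using that
    proof (induction i)
      case (Suc i)
      have "greedy R i \<le> \<phi> (Suc i)"
      proof (cases "i = 0")
        case False
        then have "greedy R i \<le> \<phi> i" using Suc by auto
        also have "\<phi> i \<le> \<phi> (Suc i)" using Hom Suc.prems False by (auto simp: Hom_def mono_on_def)
        finally show ?thesis .
      qed simp
      moreover have "\<phi> (Suc i) \<le> e" using Hom Suc.prems by (auto simp: Hom_def)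
      moreover have "(Suc i, \<phi> (Suc i)) \<notin> A" using miss Suc.prems by blast
      ultimately show ?case using Suc.prems by (auto simp: A_def)
    qed simp
    \<comment> \<open>Restriction makes the greedy map extensional, as membership in
      \<open>Hom\<close> demands. Its values stay within \<open>e\<close> because
      \<open>\<phi>\<close> lies above it.\<close>
    define \<psi> where "\<psi> = restrict (greedy R) {1..n}"
    have "greedy R i \<le> e" if "i \<in> {1..n}" for i
      using le[OF that] Hom_le[OF Hom that] by (rule order_trans)
    then have "\<psi> \<in> Hom {1..n} {0..e}"
      using greedy_mono[OF R] by (auto simp: \<psi>_def Hom_def mono_on_def)
    moreover have "ple {1..n} \<psi> \<phi>" using le by (auto simp: ple_def \<psi>_def)
    ultimately have "\<psi> \<in> J" using J phi by (auto simp: poset_ideal_def)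
    then obtain i where "i \<in> {1..n}" "alpha (i, \<psi> i) \<in> R" using hit by blast
    then show False using greedy_Suc(2)[OF R, of "i - 1"] by (auto simp: alpha_def \<psi>_def)
  qed
  ultimately show ?thesis by (intro exI[of _ A]) (auto simp: A_def)
qed

section \<open>Reversal of both chains\<close>

definition rev_map :: "nat \<Rightarrow> nat \<Rightarrow> (nat \<Rightarrow> nat) \<Rightarrow> nat \<Rightarrow> nat" where
  "rev_map n e \<phi> = (\<lambda>i\<in>{1..n}. e - \<phi> (n + 1 - i))"

text \<open>The reversals of source and target cancel for monotonicity of a single map. The
  pointwise order of maps feels only the reversal of the target, which is what exchanges up-sets and
  down-sets.\<close>

lemma rev_map_Hom:
  assumes phi: "\<phi> \<in> Hom {1..n} {0..e}"
  shows "rev_map n e \<phi> \<in> Hom {1..n} {0..e}"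
proof -
  have "\<phi> (n + 1 - l) \<le> \<phi> (n + 1 - k)" if "k \<in> {1..n}" "l \<in> {1..n}" "k \<le> l" for k l
  proof -
    have "n + 1 - l \<in> {1..n}" "n + 1 - k \<in> {1..n}" "n + 1 - l \<le> n + 1 - k" using that by auto
    then show ?thesis using phi by (simp add: Hom_def mono_on_def)
  qed
  then have "mono_on {1..n} (rev_map n e \<phi>)"
    by (intro mono_onI) (simp add: rev_map_def diff_le_mono2)
  then show ?thesis by (auto simp: Hom_def rev_map_def)
qed

lemma rev_map_rev_map:
  assumes "\<phi> \<in> Hom {1..n} {0..e}"
  shows "rev_map n e (rev_map n e \<phi>) = \<phi>"
proof
  fix i
  show "rev_map n e (rev_map n e \<phi>) i = \<phi> i"
  proof (cases "i \<in> {1..n}")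
    case True
    moreover have "\<phi> i \<le> e" using assms True by (auto simp: Hom_def)
    ultimately show ?thesis by (auto simp: rev_map_def)
  next
    case False
    then show ?thesis using assms by (auto simp: rev_map_def Hom_def PiE_def extensional_def)
  qed
qed

text \<open>Under \<open>alpha\<close> the half-turn \<open>c\<close> of the grid becomes the
  reflection \<open>d\<close> of \<open>{1..n + 2 * e}\<close>. So the reversed maps and the
  reflected set satisfy the hypotheses of \<open>down_set_lift\<close>, and the resulting lift is
  turned back by \<open>c\<close>.\<close>

lemma up_set_lift:
  assumes J: "poset_ideal (Hom {1..n} {0..e}) (\<lambda>\<phi> \<psi>. ple {1..n} \<psi> \<phi>) J"
    and R: "R \<subseteq> {1..n + 2 * e}" and hit: "\<And>\<phi>. \<phi> \<in> J \<Longrightarrow> \<exists>i\<in>{1..n}. alpha (i, \<phi> i) \<in> R"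
  shows "\<exists>A \<subseteq> grid n e. inj_on alpha A \<and> alpha ` A \<subseteq> R \<and> (\<forall>\<phi>\<in>J. \<exists>i\<in>{1..n}. (i, \<phi> i) \<in> A)"
proof -
  define c where "c = (\<lambda>(i, j). (n + 1 - i, e - j))"
  define d where "d r = n + 2 * e + 1 - r" for r
  have alpha_c: "alpha (c x) = d (alpha x)" if "x \<in> grid n e" for x
    using that by (auto simp: c_def d_def alpha_def)
  \<comment> \<open>Subtraction on \<open>nat\<close> truncates, so \<open>c\<close> and
    \<open>d\<close> are inverted only on the grid and on \<open>{1..n + 2 * e}\<close>
    respectively.\<close>
  have c_grid: "c x \<in> grid n e" and cc: "c (c x) = x" if "x \<in> grid n e" for x
    using that by (auto simp: c_def)
  have dd: "d (d r) = r" if "r \<in> {1..n + 2 * e}" for r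
    using that by (auto simp: d_def)
  have alpha_grid: "alpha x \<in> {1..n + 2 * e}" if "x \<in> grid n e" for x
    using that by (auto simp: alpha_def)
  have JH: "J \<subseteq> Hom {1..n} {0..e}" using J by (auto simp: poset_ideal_def)
  have graph: "(i, \<phi> i) \<in> grid n e" if "\<phi> \<in> J" "i \<in> {1..n}" for \<phi> i
    using JH that by (force simp: Hom_def)
  have c_graph: "c (i, \<phi> i) = (n + 1 - i, rev_map n e \<phi> (n + 1 - i))" "n + 1 - i \<in> {1..n}"
    if "i \<in> {1..n}" for \<phi> i
    using that by (auto simp: c_def rev_map_def)
  have J': "poset_ideal (Hom {1..n} {0..e}) (ple {1..n}) (rev_map n e ` J)"
    unfolding poset_ideal_def
  proof (intro conjI ballI impI)
    show "rev_map n e ` J \<subseteq> Hom {1..n} {0..e}" using JH rev_map_Hom by blast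
    fix \<chi> \<psi> assume "\<chi> \<in> rev_map n e ` J" and psi: "\<psi> \<in> Hom {1..n} {0..e}" and le: "ple {1..n} \<psi> \<chi>"
    then obtain \<phi> where phi: "\<phi> \<in> J" "\<chi> = rev_map n e \<phi>" by blast
    have "\<psi> (n + 1 - i) \<le> \<chi> (n + 1 - i)" if "i \<in> {1..n}" for i
    proof -
      have "n + 1 - i \<in> {1..n}" using that by auto
      then show ?thesis using le unfolding ple_def by blast
    qed
    \<comment> \<open>Reversing \<open>\<psi> \<le> rev_map n e \<phi>\<close> flips it, and the
      involution turns the left side into \<open>\<phi>\<close>; the up-set property of
      \<open>J\<close> then applies to \<open>rev_map n e \<psi>\<close>.\<close>
    then have "ple {1..n} (rev_map n e (rev_map n e \<phi>)) (rev_map n e \<psi>)"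
      by (simp add: ple_def rev_map_def[of _ _ \<psi>] rev_map_def[of _ _ "rev_map n e \<phi>"] phi(2)
          diff_le_mono2)
    then have "ple {1..n} \<phi> (rev_map n e \<psi>)" using rev_map_rev_map phi JH by auto
    then have "rev_map n e \<psi> \<in> J" using J phi rev_map_Hom[OF psi] by (auto simp: poset_ideal_def)
    then show "\<psi> \<in> rev_map n e ` J" using rev_map_rev_map[OF psi] by (metis imageI)
  qed
  have "\<exists>i\<in>{1..n}. alpha (i, \<chi> i) \<in> d ` R" if chi: "\<chi> \<in> rev_map n e ` J" for \<chi>
  proof -
    obtain \<phi> where phi: "\<phi> \<in> J" "\<chi> = rev_map n e \<phi>" using chi by blast
    then obtain i where i: "i \<in> {1..n}" "alpha (i, \<phi> i) \<in> R" using hit by blast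
    then have "alpha (c (i, \<phi> i)) \<in> d ` R" using alpha_c[OF graph] phi by auto
    then show ?thesis using c_graph i phi by (intro bexI[of _ "n + 1 - i"]) auto
  qed
  from down_set_lift[OF J' _ this] obtain A where A: "A \<subseteq> grid n e" "inj_on alpha A"
      "alpha ` A \<subseteq> d ` R" "\<forall>\<chi>\<in>rev_map n e ` J. \<exists>i\<in>{1..n}. (i, \<chi> i) \<in> A"
    using finite_subset[OF R] by blast
  show ?thesis
  proof (intro exI[of _ "c ` A"] conjI ballI)
    show "c ` A \<subseteq> grid n e" using A(1) c_grid by blast
    show "inj_on alpha (c ` A)"
    proof (intro inj_on_imageI inj_onI, unfold o_apply)
      fix x y assume xy: "x \<in> A" "y \<in> A" "alpha (c x) = alpha (c y)"
      then have "d (d (alpha x)) = d (d (alpha y))" using A(1) alpha_c by (metis subsetD)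
      then have "alpha x = alpha y" using xy A(1) dd alpha_grid by (metis subsetD)
      then show "x = y" using xy A(2) by (auto dest: inj_onD)
    qed
    show "alpha ` c ` A \<subseteq> R"
      unfolding image_image
    proof (rule image_subsetI)
      fix x assume x: "x \<in> A"
      then obtain r where "r \<in> R" "alpha x = d r" using A(3) by blast
      moreover have "alpha (c x) = d (alpha x)" using x A(1) by (intro alpha_c) blast
      ultimately show "alpha (c x) \<in> R" using dd R by (metis subsetD)
    qed
    fix \<phi> assume phi: "\<phi> \<in> J"
    then obtain i where i: "i \<in> {1..n}" "(i, rev_map n e \<phi> i) \<in> A" using A(4) by blast
    let ?i = "n + 1 - i"
    have i': "?i \<in> {1..n}" and "n + 1 - ?i = i" using i by auto
    then have "c (?i, \<phi> ?i) \<in> A" using c_graph(1)[of ?i \<phi>] i by simp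
    then have "(?i, \<phi> ?i) \<in> c ` A" using cc[OF graph[OF phi i']] by (metis imageI)
    then show "\<exists>i\<in>{1..n}. (i, \<phi> i) \<in> c ` A" using i' by blast
  qed
qed

subsection \<open>Faces of the squeezed ball\<close>

text \<open>By monotonicity the places with value below \<open>p\<close> form an initial segment of
  \<open>{1..n}\<close>, so belonging to it means not exceeding its size. This is the Galois
  connection between a partition and its dual.\<close>

lemma less_iff_le_card:
  assumes phi: "\<phi> \<in> Hom {1..n} {0..e}" and i: "i \<in> {1..n}"
  shows "\<phi> i < p \<longleftrightarrow> i \<le> card {k\<in>{1..n}. \<phi> k < p}"
proof
  have mono: "\<phi> k \<le> \<phi> l" if "k \<le> l" "k \<in> {1..n}" "l \<in> {1..n}" for k l
    using phi that by (auto simp: Hom_def mono_on_def)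
  show "i \<le> card {k\<in>{1..n}. \<phi> k < p}" if "\<phi> i < p"
  proof -
    have "{1..i} \<subseteq> {k\<in>{1..n}. \<phi> k < p}" using that i mono[of _ i] by fastforce
    then have "card {1..i} \<le> card {k\<in>{1..n}. \<phi> k < p}" by (intro card_mono) auto
    then show ?thesis by simp
  qed
  show "\<phi> i < p" if "i \<le> card {k\<in>{1..n}. \<phi> k < p}"
  proof (rule ccontr)
    assume "\<not> \<phi> i < p"
    then have "k < i" if "k \<in> {1..n}" "\<phi> k < p" for k
      using that i mono[of i k] by (cases "k < i") auto
    then have "{k\<in>{1..n}. \<phi> k < p} \<subseteq> {1..<i}" by auto
    then have "card {k\<in>{1..n}. \<phi> k < p} \<le> card {1..<i}" by (intro card_mono) auto
    then show False using that i by auto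
  qed
qed

lemma Psi_dual_partition:
  assumes "\<phi> \<in> Hom {1..n} {0..e}" "p \<in> {1..e}"
  shows "Psi e (dual_partition n e \<phi>) p = card {i\<in>{1..n}. \<phi> i < p} + 2 * p - 1"
  using assms by (simp add: Psi_def dual_partition_eq)

lemma Psi_dual_partition_inj:
  assumes phi: "\<phi> \<in> Hom {1..n} {0..e}" and psi: "\<psi> \<in> Hom {1..n} {0..e}"
    and eq: "Psi e (dual_partition n e \<phi>) = Psi e (dual_partition n e \<psi>)"
  shows "\<phi> = \<psi>"
proof
  fix i
  show "\<phi> i = \<psi> i"
  proof (cases "i \<in> {1..n}")
    case True
    have "card {i\<in>{1..n}. \<phi> i < p} = card {i\<in>{1..n}. \<psi> i < p}" if "p \<in> {1..e}" for p
      using Psi_dual_partition[OF phi that] Psi_dual_partition[OF psi that] eq that by auto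
    then have *: "\<phi> i < p \<longleftrightarrow> \<psi> i < p" if "p \<in> {1..e}" for p
      using less_iff_le_card[OF phi True] less_iff_le_card[OF psi True] that by simp
    have "\<phi> i \<le> e" "\<psi> i \<le> e" using phi psi True by (auto simp: Hom_def)
    \<comment> \<open>If the two values differed, the larger would be a threshold in
      \<open>{1..e}\<close> that separates them.\<close>
    then show ?thesis using *[of "\<phi> i"] *[of "\<psi> i"] by (cases "\<phi> i" "\<psi> i" rule: linorder_cases) auto
  next
    case False
    then show ?thesis using phi psi by (auto simp: Hom_def PiE_def extensional_def)
  qed
qed

text \<open>The counts increase weakly and are at most \<open>n\<close>; the summand
  \<open>2 * p - 1\<close> supplies the gaps of 2 and the last entry at most
  \<open>n + 2 * e - 1\<close>. For \<open>e = 0\<close> the index \<open>e\<close> would fall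
  outside the domain of the sequence.\<close>

lemma Psi_dual_partition_mem:
  assumes phi: "\<phi> \<in> Hom {1..n} {0..e}" and e: "e \<ge> 1"
  shows "Psi e (dual_partition n e \<phi>) \<in> F_below e (n + 2 * e)"
proof -
  let ?c = "\<lambda>p. card {i\<in>{1..n}. \<phi> i < p}"
  have mono: "?c p \<le> ?c q" if "p \<le> q" for p q
    using that by (intro card_mono) auto
  have le: "?c p \<le> n" for p
    by (rule order_trans[OF card_mono[of "{1..n}"]]) auto
  let ?i = "Psi e (dual_partition n e \<phi>)"
  have ext: "?i \<in> {1..e} \<rightarrow>\<^sub>E {1..}" by (auto simp: Psi_def)
  moreover have "strict_mono_on {1..e} ?i"
  proof (rule strict_mono_onI)
    fix p q assume "p \<in> {1..e}" "q \<in> {1..e}" "p < q"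
    then show "?i p < ?i q"
      using mono[of p q] by (simp add: Psi_dual_partition[OF phi])
  qed
  moreover have "?i p - ?i (p - 1) \<ge> 2" if "p \<in> {2..e}" for p
  proof -
    have "p \<in> {1..e}" "p - 1 \<in> {1..e}" using that by auto
    then show ?thesis using mono[of "p - 1" p] that by (simp only: Psi_dual_partition[OF phi]) auto
  qed
  moreover have "?i e < n + 2 * e"
    using le[of e] e by (simp add: Psi_dual_partition[OF phi])
  ultimately show ?thesis by (auto simp: F_below_def F_def)
qed

text \<open>The facts \<open>disj\<close> and \<open>cover\<close> say that the facet and the values
  \<open>alpha (i, \<phi> i)\<close> are complementary in \<open>{1..n + 2 * e}\<close>.\<close>

lemma subset_hat_iff:
  assumes phi: "\<phi> \<in> Hom {1..n} {0..e}" and R: "R \<subseteq> {1..n + 2 * e}"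
  shows "R \<subseteq> hat e (Psi e (dual_partition n e \<phi>)) \<longleftrightarrow> (\<forall>i\<in>{1..n}. alpha (i, \<phi> i) \<notin> R)"
proof -
  define c where "c = (\<lambda>p. card {i\<in>{1..n}. \<phi> i < p})"
  have hat: "hat e (Psi e (dual_partition n e \<phi>)) = (\<Union>p\<in>{1..e}. {c p + 2 * p - 1, c p + 2 * p})"
    unfolding hat_def by (intro SUP_cong refl) (auto simp: Psi_dual_partition[OF phi] c_def)
  \<comment> \<open>If \<open>\<phi> i < p\<close>, then \<open>i \<le> c p\<close> and the square
    lies at or before \<open>c p + 2 * p - 2\<close>. Otherwise \<open>i > c p\<close> and it lies
    at or after \<open>c p + 2 * p + 1\<close>.\<close>
  have disj: "alpha (i, \<phi> i) \<notin> {c p + 2 * p - 1, c p + 2 * p}" if "i \<in> {1..n}" for i p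
    using less_iff_le_card[OF phi that, of p] by (cases "\<phi> i < p") (auto simp: alpha_def c_def)
  have "break_sequence n e \<phi> c"
    unfolding c_def by (rule break_sequence_exists[OF phi])
  then have c: "c 0 = 0" "c (e + 1) = n"
      and const: "\<And>p i. p \<in> {0..e} \<Longrightarrow> i \<in> {c p + 1..c (p + 1)} \<Longrightarrow> \<phi> i = p"
    by (simp_all add: break_sequence_def)
  have c_le: "c p \<le> n" for p
    unfolding c_def by (rule order_trans[OF card_mono[of "{1..n}"]]) auto
  have cover: "r \<in> hat e (Psi e (dual_partition n e \<phi>)) \<or> (\<exists>i\<in>{1..n}. r = alpha (i, \<phi> i))"
    if r: "r \<in> {1..n + 2 * e}" for r
  proof -
    \<comment> \<open>Domino \<open>p\<close> is the last one that ends at or before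
      \<open>r\<close>, with \<open>p = 0\<close> standing for a virtual domino ending at 0. Thus
      \<open>r\<close> ends domino \<open>p\<close>, starts domino \<open>p + 1\<close>, or lies
      strictly between them, where \<open>\<phi>\<close> has value \<open>p\<close>. For
      \<open>p = e\<close> there is no next domino and \<open>c (e + 1) = n\<close> bounds
      \<open>r\<close>.\<close>
    define p where "p = (GREATEST p. p \<le> e \<and> c p + 2 * p \<le> r)"
    have p: "p \<le> e \<and> c p + 2 * p \<le> r"
      unfolding p_def by (rule GreatestI_nat[of _ 0 e]) (auto simp: c)
    have max: "q \<le> p" if "q \<le> e \<and> c q + 2 * q \<le> r" for q
      unfolding p_def by (rule Greatest_le_nat[of _ q e]) (use that in auto)
    consider "r = c p + 2 * p" | "p < e" "r = c (p + 1) + 2 * p + 1"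
      | "r - 2 * p \<in> {c p + 1..c (p + 1)}"
    proof (cases "p = e")
      case True
      then show thesis using that p r c(2) by fastforce
    next
      case False
      then have "r < c (p + 1) + 2 * (p + 1)" using max[of "p + 1"] p by linarith
      then show thesis using that p False by fastforce
    qed
    then show ?thesis
    proof cases
      case 1
      then have "p \<in> {1..e}" using p r c(1) by (cases "p = 0") auto
      then show ?thesis using 1 unfolding hat by blast
    next
      case 2
      then have "p + 1 \<in> {1..e}" "r = c (p + 1) + 2 * (p + 1) - 1" by auto
      then show ?thesis unfolding hat by blast
    next
      case 3
      then have "\<phi> (r - 2 * p) = p" using const p by simp
      moreover have "r - 2 * p \<in> {1..n}" using 3 c_le[of "p + 1"] by simp
      ultimately show ?thesis using p by (auto simp: alpha_def intro!: bexI[of _ "r - 2 * p"])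
    qed
  qed
  show ?thesis
  proof
    show "\<forall>i\<in>{1..n}. alpha (i, \<phi> i) \<notin> R" if "R \<subseteq> hat e (Psi e (dual_partition n e \<phi>))"
      using disj that unfolding hat by blast
    show "R \<subseteq> hat e (Psi e (dual_partition n e \<phi>))" if "\<forall>i\<in>{1..n}. alpha (i, \<phi> i) \<notin> R"
      using cover that R by blast
  qed
qed

text \<open>Dualizing reverses the order while \<open>Psi\<close> preserves it, so a down-set of
  sequences gives an up-set of maps. Injectivity brings membership in the image back to
  \<open>J\<close>.\<close>

lemma up_set_of_F_below_ideal:
  assumes e: "e \<ge> 1" and J: "J \<subseteq> Hom {1..n} {0..e}"
    and I: "poset_ideal (F_below e (n + 2 * e)) (ple {1..e}) ((\<lambda>\<phi>. Psi e (dual_partition n e \<phi>)) ` J)"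
  shows "poset_ideal (Hom {1..n} {0..e}) (\<lambda>\<phi> \<psi>. ple {1..n} \<psi> \<phi>) J"
  unfolding poset_ideal_def
proof (intro conjI ballI impI J)
  fix \<phi> \<psi> assume phi: "\<phi> \<in> J" and psi: "\<psi> \<in> Hom {1..n} {0..e}" and le: "ple {1..n} \<phi> \<psi>"
  have "ple {1..e} (dual_partition n e \<psi>) (dual_partition n e \<phi>)"
    using dual_partition_antimono psi le phi J by blast
  then have "ple {1..e} (Psi e (dual_partition n e \<psi>)) (Psi e (dual_partition n e \<phi>))"
    by (auto simp: ple_def Psi_def intro!: diff_le_mono)
  then have "Psi e (dual_partition n e \<psi>) \<in> (\<lambda>\<phi>. Psi e (dual_partition n e \<phi>)) ` J"
    using I phi Psi_dual_partition_mem[OF psi e] unfolding poset_ideal_def by blast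
  then show "\<psi> \<in> J" using Psi_dual_partition_inj[OF psi] J by auto
qed

subsection \<open>Monomial ideals\<close>

lemma lookup_sum_single:
  "finite S \<Longrightarrow> Poly_Mapping.lookup (\<Sum>s\<in>S. Poly_Mapping.single s (m s)) v = (if v \<in> S then m v else 0)"
  by (induction S rule: finite_induct) (auto simp: lookup_add lookup_single when_def)

lemma monomial_add: "monomial (a + b) = monomial a * monomial b"
  by (simp add: monomial_def mult_single)

lemma monomial_0: "monomial 0 = 1"
  by (simp add: monomial_def)

lemma prod_monomial: "(\<Prod>s\<in>S. monomial (m s)) = monomial (\<Sum>s\<in>S. m s)"
  by (induction S rule: infinite_finite_induct) (auto simp: monomial_add monomial_0)

lemma X_power: "X v ^ k = monomial (Poly_Mapping.single v k)"
  by (induction k) (auto simp: X_def monomial_0 single_add[symmetric] monomial_add[symmetric])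

lemma keys_monomial: "Poly_Mapping.keys (monomial u :: ('v, 'k::field) mpoly) = {u}"
  by (simp add: monomial_def)

lemma monomial_dvd_iff:
  "(monomial d :: ('v, 'k::field) mpoly) dvd monomial u \<longleftrightarrow> (\<exists>k. u = d + k)"
proof
  assume "(monomial d :: ('v, 'k) mpoly) dvd monomial u"
  then obtain q :: "('v, 'k) mpoly" where "monomial u = monomial d * q" by (auto simp: dvd_def)
  \<comment> \<open>The quotient \<open>q\<close> is not known to be a monomial, but one of its
    exponents must account for \<open>u\<close>.\<close>
  then have "u \<in> Poly_Mapping.keys (monomial d * q)" by (metis keys_monomial singletonI)
  then show "\<exists>k. u = d + k" using Poly_Mapping.keys_mult[of "monomial d" q] by (auto simp: keys_monomial)
qed (auto simp: monomial_add)

lemma keys_add_nat: "Poly_Mapping.keys (a + b :: 'v \<Rightarrow>\<^sub>0 nat) = Poly_Mapping.keys a \<union> Poly_Mapping.keys b"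
  by (auto simp: in_keys_iff lookup_add)

text \<open>A nonzero common exponent involves some shared variable, and a shared variable is itself
  a common divisor. Hence the Alexander dual condition depends on supports alone.\<close>

lemma common_divisor_iff:
  "(\<exists>d. d \<noteq> 0 \<and> (monomial d :: ('v, 'k::field) mpoly) dvd monomial u \<and>
      (monomial d :: ('v, 'k) mpoly) dvd monomial w)
    \<longleftrightarrow> Poly_Mapping.keys u \<inter> Poly_Mapping.keys w \<noteq> {}"
proof
  assume "\<exists>d. d \<noteq> 0 \<and> (monomial d :: ('v, 'k) mpoly) dvd monomial u \<and>
      (monomial d :: ('v, 'k) mpoly) dvd monomial w"
  then obtain d k l where d: "d \<noteq> 0" "u = d + k" "w = d + l"
    unfolding monomial_dvd_iff by blast
  then have "Poly_Mapping.keys d \<subseteq> Poly_Mapping.keys u \<inter> Poly_Mapping.keys w"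
    by (simp add: keys_add_nat)
  then show "Poly_Mapping.keys u \<inter> Poly_Mapping.keys w \<noteq> {}"
    using d(1) by (metis keys_eq_empty subset_empty)
next
  assume "Poly_Mapping.keys u \<inter> Poly_Mapping.keys w \<noteq> {}"
  then obtain v where v: "v \<in> Poly_Mapping.keys u" "v \<in> Poly_Mapping.keys w" by blast
  have div: "\<exists>k. m = Poly_Mapping.single v 1 + k" if "v \<in> Poly_Mapping.keys m" for m :: "'v \<Rightarrow>\<^sub>0 nat"
    using that
    by (intro exI[of _ "m - Poly_Mapping.single v 1"] poly_mapping_eqI)
       (auto simp: lookup_add lookup_minus lookup_single when_def in_keys_iff)
  have "Poly_Mapping.single v (1::nat) \<noteq> 0"
    by (metis lookup_single_eq lookup_zero one_neq_zero)
  then show "\<exists>d. d \<noteq> 0 \<and> (monomial d :: ('v, 'k) mpoly) dvd monomial u \<and>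
      (monomial d :: ('v, 'k) mpoly) dvd monomial w"
    unfolding monomial_dvd_iff using div v by (intro exI[of _ "Poly_Mapping.single v 1"]) auto
qed

lemma ring_mpoly_ring: "ring (mpoly_ring V)"
  using cring_mpoly_ring by (rule cring.axioms(1))

lemma mpoly_ring_simps:
  "x \<oplus>\<^bsub>mpoly_ring V\<^esub> y = x + y" "x \<otimes>\<^bsub>mpoly_ring V\<^esub> y = x * y"
  "\<one>\<^bsub>mpoly_ring V\<^esub> = 1" "\<zero>\<^bsub>mpoly_ring V\<^esub> = 0"
  by (simp_all add: mpoly_ring_def)

lemma monomial_carrier_iff: "monomial u \<in> carrier (mpoly_ring V) \<longleftrightarrow> Poly_Mapping.keys u \<subseteq> V"
  by (simp add: mpoly_ring_def keys_monomial)

text \<open>The scalar factor gives the conclusion the shape of a summand in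
  \<open>rename_eq\<close>. The condition on the keys of \<open>u\<close> keeps the cofactor in the
  ring over \<open>V\<close>.\<close>

lemma ideal_monomial_multiple:
  assumes I: "ideal I (mpoly_ring V)" and d: "monomial d \<in> I"
    and "(monomial d :: ('v, 'k::field) mpoly) dvd monomial u" and u: "Poly_Mapping.keys u \<subseteq> V"
  shows "Poly_Mapping.single 0 c * (monomial u :: ('v, 'k) mpoly) \<in> I"
proof -
  obtain k where k: "u = d + k" using assms(3) unfolding monomial_dvd_iff by blast
  have "Poly_Mapping.single k c \<in> carrier (mpoly_ring V)"
    using u by (auto simp: mpoly_ring_def k keys_add_nat)
  then have "monomial d * Poly_Mapping.single k c \<in> I"
    using ideal.I_r_closed[OF I d] by (simp add: mpoly_ring_simps)
  then show ?thesis by (simp add: monomial_def mult_single k)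
qed

lemma ideal_sum:
  assumes I: "ideal I (mpoly_ring V)" and "\<And>s. s \<in> S \<Longrightarrow> f s \<in> I"
  shows "(\<Sum>s\<in>S. f s) \<in> I"
  using assms(2)
proof (induction S rule: infinite_finite_induct)
  case (insert s S)
  then show ?case
    using additive_subgroup.a_closed[OF ideal.axioms(1)[OF I], of "f s" "sum f S"]
    by (simp add: mpoly_ring_simps)
qed (use additive_subgroup.zero_closed[OF ideal.axioms(1)[OF I]] in \<open>simp_all add: mpoly_ring_simps\<close>)

text \<open>Exponents of a sum come from its summands, and an exponent of a product extends one of
  the first factor, so a property stable under adding exponents is inherited. Such ideals serve as
  upper bounds for ideals generated by monomials.\<close>

lemma ideal_of_supports:
  fixes V :: "'v set"
  assumes P: "\<And>m m'. P m \<Longrightarrow> P (m + m')"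
  shows "ideal {p \<in> carrier (mpoly_ring V). \<forall>m\<in>Poly_Mapping.keys p. P m} (mpoly_ring V :: ('v, 'k::field) mpoly ring)"
    (is "ideal ?I ?R")
proof -
  interpret R: cring ?R by (rule cring_mpoly_ring)
  have mult: "p * q \<in> ?I" if p: "p \<in> ?I" and q: "q \<in> carrier ?R" for p q
  proof -
    have "p * q \<in> carrier ?R" using R.m_closed[of p q] p q by (auto simp: mpoly_ring_simps)
    moreover have "P m" if "m \<in> Poly_Mapping.keys (p * q)" for m
      using subsetD[OF Poly_Mapping.keys_mult[of p q] that] p P by blast
    ultimately show ?thesis by blast
  qed
  have neg: "\<ominus>\<^bsub>?R\<^esub> p = - p" if "p \<in> carrier ?R" for p
  proof (rule R.minus_equality)
    show "- p \<oplus>\<^bsub>?R\<^esub> p = \<zero>\<^bsub>?R\<^esub>" by (simp add: mpoly_ring_simps)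
    show "- p \<in> carrier ?R" using that by (auto simp: mpoly_ring_def in_keys_iff)
  qed (use that in auto)
  have "subgroup ?I (add_monoid ?R)"
  proof (rule R.add.subgroupI)
    show "?I \<noteq> {}" using R.zero_closed by (auto simp: mpoly_ring_simps intro!: exI[of _ 0])
    fix p q assume p: "p \<in> ?I" and q: "q \<in> ?I"
    have "Poly_Mapping.keys (p + q) \<subseteq> Poly_Mapping.keys p \<union> Poly_Mapping.keys q"
      by (rule Poly_Mapping.keys_add)
    then show "p \<oplus>\<^bsub>?R\<^esub> q \<in> ?I" using p q R.a_closed[of p q] by (auto simp: mpoly_ring_simps)
    have "\<ominus>\<^bsub>?R\<^esub> p \<in> carrier ?R" using p by simp
    then have "- p \<in> carrier ?R" using neg p by simp
    then show "\<ominus>\<^bsub>?R\<^esub> p \<in> ?I" using p neg by (auto simp: in_keys_iff)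
  qed auto
  then show ?thesis
  proof (rule idealI[OF R.ring_axioms])
    fix p q assume p: "p \<in> ?I" and q: "q \<in> carrier ?R"
    show "p \<otimes>\<^bsub>?R\<^esub> q \<in> ?I" using mult[OF p q] by (simp only: mpoly_ring_simps)
    then show "q \<otimes>\<^bsub>?R\<^esub> p \<in> ?I" by (simp only: mpoly_ring_simps mult.commute)
  qed
qed

text \<open>This is an induction principle for generated ideals: minimality puts \<open>Idl\<close>
  inside the ideal of \<open>ideal_of_supports\<close>.\<close>

lemma keys_Idl:
  fixes G :: "('v, 'k::field) mpoly set"
  assumes "p \<in> Idl\<^bsub>mpoly_ring V\<^esub> G" and "G \<subseteq> carrier (mpoly_ring V)"
    and "\<And>g m. g \<in> G \<Longrightarrow> m \<in> Poly_Mapping.keys g \<Longrightarrow> P m" and "\<And>m m'. P m \<Longrightarrow> P (m + m')"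
    and "m \<in> Poly_Mapping.keys p"
  shows "Poly_Mapping.keys m \<subseteq> V \<and> P m"
proof -
  have "Idl\<^bsub>mpoly_ring V\<^esub> G \<subseteq> {p \<in> carrier (mpoly_ring V). \<forall>m\<in>Poly_Mapping.keys p. P m}"
    using assms(2,3) by (intro ring.genideal_minimal ring_mpoly_ring ideal_of_supports assms(4)) auto
  then show ?thesis using assms(1,5) by (auto simp: mpoly_ring_def)
qed

section \<open>Squarefree monomials and renaming of variables\<close>

definition sqfree_exp :: "'v set \<Rightarrow> 'v \<Rightarrow>\<^sub>0 nat" where
  "sqfree_exp S = (\<Sum>s\<in>S. Poly_Mapping.single s 1)"

lemma prod_X: "(\<Prod>s\<in>S. X s) = monomial (sqfree_exp S)"
  by (simp add: X_def prod_monomial sqfree_exp_def)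

text \<open>Finiteness matters because the sum defining \<open>sqfree_exp\<close> defaults to 0 on
  an infinite set.\<close>

lemma lookup_sqfree_exp: "finite S \<Longrightarrow> Poly_Mapping.lookup (sqfree_exp S) v = (if v \<in> S then 1 else 0)"
  unfolding sqfree_exp_def by (rule lookup_sum_single)

lemma keys_sqfree_exp: "finite S \<Longrightarrow> Poly_Mapping.keys (sqfree_exp S) = S"
  by (auto simp: in_keys_iff lookup_sqfree_exp split: if_splits)

lemma sqfree_exp_dvd:
  assumes "finite S" "S \<subseteq> Poly_Mapping.keys u"
  shows "(monomial (sqfree_exp S) :: ('v, 'k::field) mpoly) dvd monomial u"
  unfolding monomial_dvd_iff
proof (intro exI[of _ "u - sqfree_exp S"] poly_mapping_eqI)
  fix v show "Poly_Mapping.lookup u v = Poly_Mapping.lookup (sqfree_exp S + (u - sqfree_exp S)) v"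
    using assms by (auto simp: lookup_add lookup_minus lookup_sqfree_exp in_keys_iff subset_iff)
qed

text \<open>This is the exponent of the image of a monomial under \<open>rename f\<close>; exponents
  over one fibre of \<open>f\<close> add up.\<close>

definition push_exp :: "('v \<Rightarrow> 'w) \<Rightarrow> ('v \<Rightarrow>\<^sub>0 nat) \<Rightarrow> ('w \<Rightarrow>\<^sub>0 nat)" where
  "push_exp f m = (\<Sum>v\<in>Poly_Mapping.keys m. Poly_Mapping.single (f v) (Poly_Mapping.lookup m v))"

lemma keys_push_exp: "Poly_Mapping.keys (push_exp f m) = f ` Poly_Mapping.keys m"
proof -
  have "Poly_Mapping.keys (\<Sum>v\<in>S. Poly_Mapping.single (f v) (Poly_Mapping.lookup m v)) = f ` S"
    if "finite S" "S \<subseteq> Poly_Mapping.keys m" for S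
    using that by (induction S rule: finite_induct) (auto simp: keys_add_nat in_keys_iff)
  then show ?thesis by (simp add: push_exp_def)
qed

text \<open>Two points with the same image would produce an exponent above 1. This is why non-faces
  have to be lifted injectively.\<close>

lemma push_exp_sqfree_exp:
  assumes "finite S" "inj_on f S"
  shows "push_exp f (sqfree_exp S) = sqfree_exp (f ` S)"
  unfolding push_exp_def keys_sqfree_exp[OF assms(1)] sqfree_exp_def[of "f ` S"] sum.reindex[OF assms(2)]
  by (rule sum.cong) (auto simp: lookup_sqfree_exp assms(1))

lemma rename_eq:
  "rename f p = (\<Sum>m\<in>Poly_Mapping.keys p.
     Poly_Mapping.single 0 (Poly_Mapping.lookup p m) * monomial (push_exp f m))"
  by (simp add: rename_def X_power prod_monomial push_exp_def)

lemma rename_monomial: "rename f (monomial u :: ('v, 'k::field) mpoly) = monomial (push_exp f u)"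
  unfolding rename_eq keys_monomial by (simp add: monomial_def)

lemma ideal_stanley_reisner: "finite V \<Longrightarrow> ideal (stanley_reisner_ideal V \<Delta>) (mpoly_ring V)"
  unfolding stanley_reisner_ideal_def
  by (rule ring.genideal_ideal[OF ring_mpoly_ring])
     (auto simp: prod_X monomial_carrier_iff keys_sqfree_exp finite_subset)

lemma sqfree_exp_mem_stanley_reisner:
  assumes "finite V" "R \<subseteq> V" "R \<notin> \<Delta>"
  shows "(monomial (sqfree_exp R) :: ('v, 'k::field) mpoly) \<in> stanley_reisner_ideal V \<Delta>"
proof -
  have "{\<Prod>s\<in>R. X s | R. R \<subseteq> V \<and> R \<notin> \<Delta>} \<subseteq> carrier (mpoly_ring V :: ('v, 'k) mpoly ring)"
    using assms(1) by (auto simp: prod_X monomial_carrier_iff keys_sqfree_exp finite_subset)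
  from ring.genideal_self[OF ring_mpoly_ring this]
  show ?thesis unfolding stanley_reisner_ideal_def using assms by (auto simp: prod_X)
qed

subsection \<open>Letterplace ideals\<close>

lemma prod_X_graph:
  "(\<Prod>i\<in>S. X (i, \<phi> i)) = monomial (sqfree_exp ((\<lambda>i. (i, \<phi> i)) ` S))"
  by (subst prod_X[symmetric], subst prod.reindex) (auto simp: inj_on_def)

lemma graph_subset_grid:
  assumes "J \<subseteq> Hom {1..n} {0..e}" "\<phi> \<in> J"
  shows "(\<lambda>i. (i, \<phi> i)) ` {1..n} \<subseteq> grid n e"
  using Hom_le[of \<phi> n e] assms by auto

lemma co_letterplace_generators:
  assumes "J \<subseteq> Hom {1..n} {0..e}"
  shows "{\<Prod>i\<in>{1..n}. X (i, \<phi> i) | \<phi>. \<phi> \<in> J}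
    \<subseteq> carrier (mpoly_ring (grid n e) :: (nat \<times> nat, 'k::field) mpoly ring)"
  unfolding prod_X_graph
  using graph_subset_grid[OF assms] by (force simp: monomial_carrier_iff keys_sqfree_exp)

lemma monomial_mem_co_letterplace:
  assumes J: "J \<subseteq> Hom {1..n} {0..e}"
    and w: "(monomial w :: (nat \<times> nat, 'k::field) mpoly) \<in> co_letterplace n e J"
  shows "\<exists>\<phi>\<in>J. \<forall>i\<in>{1..n}. (i, \<phi> i) \<in> Poly_Mapping.keys w"
proof -
  let ?P = "\<lambda>m. \<exists>\<phi>\<in>J. \<forall>i\<in>{1..n}. (i, \<phi> i) \<in> Poly_Mapping.keys m"
  have "Poly_Mapping.keys w \<subseteq> grid n e \<and> ?P w"
  proof (rule keys_Idl[OF w[unfolded co_letterplace_def] co_letterplace_generators[OF J]])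
    show "?P m" if "g \<in> {\<Prod>i\<in>{1..n}. X (i, \<phi> i) | \<phi>. \<phi> \<in> J}" "m \<in> Poly_Mapping.keys g"
      for g :: "(nat \<times> nat, 'k) mpoly" and m
      using that unfolding prod_X_graph by (force simp: keys_monomial keys_sqfree_exp)
    show "?P (m + m')" if "?P m" for m m' :: "nat \<times> nat \<Rightarrow>\<^sub>0 nat"
      using that unfolding keys_add_nat by blast
  qed (simp add: keys_monomial)
  then show ?thesis by blast
qed

lemma monomial_mem_letterplace:
  assumes "J \<subseteq> Hom {1..n} {0..e}" and u: "Poly_Mapping.keys u \<subseteq> grid n e"
    and hit: "\<forall>\<phi>\<in>J. \<exists>i\<in>{1..n}. (i, \<phi> i) \<in> Poly_Mapping.keys u"
  shows "(monomial u :: (nat \<times> nat, 'k::field) mpoly) \<in> letterplace n e J"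
  unfolding letterplace_def alexander_dual_def common_divisor_iff
proof (rule subsetD[OF ring.genideal_self[OF ring_mpoly_ring]])
  have "Poly_Mapping.keys u \<inter> Poly_Mapping.keys w \<noteq> {}"
    if "(monomial w :: (nat \<times> nat, 'k) mpoly) \<in> co_letterplace n e J" for w
    using monomial_mem_co_letterplace[OF assms(1) that] hit by blast
  then show "monomial u \<in> {monomial u :: (nat \<times> nat, 'k) mpoly | u. Poly_Mapping.keys u \<subseteq> grid n e \<and>
      (\<forall>w. (monomial w :: (nat \<times> nat, 'k) mpoly) \<in> co_letterplace n e J \<longrightarrow>
        Poly_Mapping.keys u \<inter> Poly_Mapping.keys w \<noteq> {})}"
    using u by blast
qed (auto simp: monomial_carrier_iff)

text \<open>A generator of the dual is tested against the graph monomials of the maps in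
  \<open>J\<close>, and meeting all these graphs is stable under enlarging the support. So
  \<open>keys_Idl\<close> carries it to every monomial of every element.\<close>

lemma keys_mem_letterplace:
  assumes J: "J \<subseteq> Hom {1..n} {0..e}"
    and p: "(p :: (nat \<times> nat, 'k::field) mpoly) \<in> letterplace n e J" and m: "m \<in> Poly_Mapping.keys p"
  shows "Poly_Mapping.keys m \<subseteq> grid n e \<and> (\<forall>\<phi>\<in>J. \<exists>i\<in>{1..n}. (i, \<phi> i) \<in> Poly_Mapping.keys m)"
proof (rule keys_Idl[OF p[unfolded letterplace_def alexander_dual_def common_divisor_iff] _ _ _ m])
  let ?gr = "\<lambda>\<phi>. (\<lambda>i. (i, \<phi> i)) ` {1..n}"
  have co: "(monomial (sqfree_exp (?gr \<phi>)) :: (nat \<times> nat, 'k) mpoly) \<in> co_letterplace n e J"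
    if "\<phi> \<in> J" for \<phi>
    unfolding co_letterplace_def
    by (rule subsetD[OF ring.genideal_self[OF ring_mpoly_ring co_letterplace_generators[OF J]]])
       (use that prod_X_graph[symmetric] in blast)
  fix g :: "(nat \<times> nat, 'k) mpoly" and m
  assume "g \<in> {monomial u | u. Poly_Mapping.keys u \<subseteq> grid n e \<and>
      (\<forall>w. (monomial w :: (nat \<times> nat, 'k) mpoly) \<in> co_letterplace n e J \<longrightarrow>
        Poly_Mapping.keys u \<inter> Poly_Mapping.keys w \<noteq> {})}" and "m \<in> Poly_Mapping.keys g"
  then have m: "Poly_Mapping.keys m \<inter> Poly_Mapping.keys w \<noteq> {}"
    if "(monomial w :: (nat \<times> nat, 'k) mpoly) \<in> co_letterplace n e J" for w
    using that by (auto simp: keys_monomial)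
  show "\<forall>\<phi>\<in>J. \<exists>i\<in>{1..n}. (i, \<phi> i) \<in> Poly_Mapping.keys m"
    using m[OF co] by (fastforce simp: keys_sqfree_exp)
qed (auto simp: monomial_carrier_iff keys_add_nat)

theorem theorem11p2:
  fixes n e :: nat
    and J :: "(nat \<Rightarrow> nat) set" and I :: "(nat \<Rightarrow> nat) set"
  assumes "n \<ge> 1" and "e \<ge> 1"
    and "J \<subseteq> Hom {1..n} {0..e}" and "I \<subseteq> F_below e (n + 2 * e)"
    and "I = (\<lambda>\<phi>. Psi e (dual_partition n e \<phi>)) ` J"
    and "poset_ideal (Hom {1..n} {0..e}) (ple {1..n}) J \<or>
         poset_ideal (F_below e (n + 2 * e)) (ple {1..e}) I"
  shows "(stanley_reisner_ideal {1..n + 2 * e} (squeezed_ball e I) :: (nat, 'k::field) mpoly set)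
           = letterplace_alpha n e J"
proof
  let ?V = "{1..n + 2 * e}"
  let ?SR = "stanley_reisner_ideal ?V (squeezed_ball e I) :: (nat, 'k) mpoly set"
  let ?LA = "letterplace_alpha n e J :: (nat, 'k) mpoly set"
  \<comment> \<open>For empty \<open>J\<close> the complex is void: every \<open>R\<close> is a
    non-face and the right side holds vacuously.\<close>
  have nonface: "R \<notin> squeezed_ball e I \<longleftrightarrow> (\<forall>\<phi>\<in>J. \<exists>i\<in>{1..n}. alpha (i, \<phi> i) \<in> R)"
    if "R \<subseteq> ?V" for R
    using subset_hat_iff[OF _ that] assms(3,5) unfolding squeezed_ball_def by blast
  have alpha_V: "alpha ` Poly_Mapping.keys m \<subseteq> ?V" if "Poly_Mapping.keys m \<subseteq> grid n e"
    for m :: "nat \<times> nat \<Rightarrow>\<^sub>0 nat"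
    using that by (fastforce simp: alpha_def)
  have SR: "ideal ?SR (mpoly_ring ?V)" by (rule ideal_stanley_reisner) simp
  \<comment> \<open>Each monomial of \<open>p\<close> meets all graphs, so the image of its support
    is a non-face. The squarefree monomial of that non-face divides the renamed monomial.\<close>
  have rename_mem: "rename alpha p \<in> ?SR" if p: "p \<in> letterplace n e J" for p
    unfolding rename_eq
  proof (rule ideal_sum[OF SR], rule ideal_monomial_multiple[OF SR])
    fix m assume "m \<in> Poly_Mapping.keys p"
    then have m: "Poly_Mapping.keys m \<subseteq> grid n e"
        "\<forall>\<phi>\<in>J. \<exists>i\<in>{1..n}. (i, \<phi> i) \<in> Poly_Mapping.keys m"
      using keys_mem_letterplace[OF assms(3) p] by auto
    let ?R = "alpha ` Poly_Mapping.keys m"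
    have "?R \<notin> squeezed_ball e I" using nonface[OF alpha_V[OF m(1)]] m(2) by blast
    then show "monomial (sqfree_exp ?R) \<in> ?SR"
      using alpha_V[OF m(1)] by (intro sqfree_exp_mem_stanley_reisner) auto
    show "(monomial (sqfree_exp ?R) :: (nat, 'k) mpoly) dvd monomial (push_exp alpha m)"
      by (rule sqfree_exp_dvd) (auto simp: keys_push_exp)
    show "Poly_Mapping.keys (push_exp alpha m) \<subseteq> ?V"
      using alpha_V[OF m(1)] by (simp add: keys_push_exp)
  qed
  then show "?LA \<subseteq> ?SR"
    unfolding letterplace_alpha_def by (intro ring.genideal_minimal[OF ring_mpoly_ring SR]) auto
  \<comment> \<open>The inclusion just obtained also places the image in the target ring, which is
    needed before its generated ideal can be used.\<close>
  have carrier: "rename alpha ` letterplace n e J \<subseteq> carrier (mpoly_ring ?V :: (nat, 'k) mpoly ring)"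
    using rename_mem ideal.Icarr[OF SR] by blast
  have LA: "ideal ?LA (mpoly_ring ?V)"
    unfolding letterplace_alpha_def by (rule ring.genideal_ideal[OF ring_mpoly_ring carrier])
  show "?SR \<subseteq> ?LA"
    unfolding stanley_reisner_ideal_def
  proof (intro ring.genideal_minimal[OF ring_mpoly_ring LA] subsetI)
    fix p :: "(nat, 'k) mpoly" assume "p \<in> {\<Prod>s\<in>R. X s | R. R \<subseteq> ?V \<and> R \<notin> squeezed_ball e I}"
    then obtain R where R: "R \<subseteq> ?V" "R \<notin> squeezed_ball e I" and p: "p = (\<Prod>s\<in>R. X s)" by blast
    have fin: "finite R" using R(1) finite_subset by blast
    have hit: "\<exists>i\<in>{1..n}. alpha (i, \<phi> i) \<in> R" if "\<phi> \<in> J" for \<phi>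
      using nonface[OF R(1)] R(2) that by blast
    have "\<exists>A \<subseteq> grid n e. inj_on alpha A \<and> alpha ` A \<subseteq> R \<and> (\<forall>\<phi>\<in>J. \<exists>i\<in>{1..n}. (i, \<phi> i) \<in> A)"
      using assms(6)
    proof
      assume "poset_ideal (Hom {1..n} {0..e}) (ple {1..n}) J"
      then show ?thesis by (rule down_set_lift[OF _ fin hit])
    next
      assume "poset_ideal (F_below e (n + 2 * e)) (ple {1..e}) I"
      then have "poset_ideal (Hom {1..n} {0..e}) (\<lambda>\<phi> \<psi>. ple {1..n} \<psi> \<phi>) J"
        using up_set_of_F_below_ideal[OF assms(2,3)] assms(5) by simp
      then show ?thesis by (rule up_set_lift[OF _ R(1) hit])
    qed
    then obtain A where A: "A \<subseteq> grid n e" "inj_on alpha A" "alpha ` A \<subseteq> R"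
        "\<forall>\<phi>\<in>J. \<exists>i\<in>{1..n}. (i, \<phi> i) \<in> A" by blast
    have finA: "finite A" using A(1) by (rule finite_subset) simp
    have "(monomial (sqfree_exp A) :: (nat \<times> nat, 'k) mpoly) \<in> letterplace n e J"
      by (rule monomial_mem_letterplace[OF assms(3)]) (use A finA in \<open>auto simp: keys_sqfree_exp\<close>)
    then have "rename alpha (monomial (sqfree_exp A) :: (nat \<times> nat, 'k) mpoly) \<in> ?LA"
      using ring.genideal_self[OF ring_mpoly_ring carrier] unfolding letterplace_alpha_def by blast
    then have "monomial (sqfree_exp (alpha ` A)) \<in> ?LA"
      by (simp add: rename_monomial push_exp_sqfree_exp[OF finA A(2)])
    \<comment> \<open>The lift may cover only part of \<open>R\<close>; since \<open>alpha\<close>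
      maps \<open>A\<close> into \<open>R\<close>, the monomial of \<open>R\<close> is a multiple of
      the one obtained.\<close>
    then have "Poly_Mapping.single 0 1 * (monomial (sqfree_exp R) :: (nat, 'k) mpoly) \<in> ?LA"
      using A(3) R(1) fin finA
      by (rule_tac ideal_monomial_multiple[OF LA]) (auto simp: keys_sqfree_exp intro!: sqfree_exp_dvd)
    then show "p \<in> ?LA" by (simp add: p prod_X)
  qed
qed

end
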